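(* Let $\theta_1,\dots,\theta_n>0$ and let $H:\mathbb{R}_+^n\to\mathbb{R}_+^n$ be the quadratic operator $H(x)=x'$ with $$x_k'=\frac{\theta_k x_k}{2}\Big(x_k+2\sum_{i\ne k}x_i\Big),\qquad k=1,\dots,n.$$ For any $n\ge 2$, the unstable manifold of a non-zero saddle fixed point $\overline{E}=(\overline{x}_1,\dots,\overline{x}_n)$ is the line (in $n$-dimensional space) $$L_n:\quad \frac{x_1}{\overline{x}_1}=\frac{x_2}{\overline{x}_2}=\dots=\frac{x_n}{\overline{x}_n},$$ which passes through the origin and $\overline{E}$, where the coordinates of $\overline{E}$ are $$\overline{x}_i=\frac{4\theta_i\sum_{1\le i_1<\dots<i_{n-2}\le n,\ i_j\ne i}\theta_{i_1}\cdots\theta_{i_{n-2}}-(4n-6)\prod_{j\ne i}\theta_j}{(2n-1)\prod_{j=1}^n\theta_j},\qquad i=1,\dots,n.$$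
   Context: $\mathbb{R}_+^n=\{x\in\mathbb{R}^n: x_i\ge 0 \text{ for all } i\}$. "Non-zero" refers to the fixed point all of whose coordinates are non-zero. A saddle is a fixed point at which the Jacobian matrix of $H$ has no eigenvalue of absolute value $1$, but has eigenvalues of absolute value less than $1$ and eigenvalues of absolute value greater than $1$. "Unstable manifold" is used in its usual sense for discrete-time dynamical systems: the invariant manifold through $\overline{E}$ along which trajectories move away from $\overline{E}$. For $n=2$ the sum in the formula consists of the single empty product, equal to $1$.
   Formalization: The unstable manifold is shown to be the part of the line L_n inside R_+^n with the origin removed, not the whole line: the origin is another fixed point whose only preimage is itself, and the rest of the line lies outside the phase space. *)

theory Defs
  imports "HOL-Analysis.Analysis"
begin

definition nonneg_orthant :: "(real^'n) set" where
  "nonneg_orthant = {x. \<forall>i. 0 \<le> x $ i}"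

(* The operator is given by its polynomial formula on the whole space; the phase space of the
   dynamical system is nonneg_orthant, which it maps into itself (lemma H_nonneg below). *)
definition H :: "real^'n \<Rightarrow> real^'n \<Rightarrow> real^'n" where
  "H \<theta> x = (\<chi> k. \<theta> $ k * x $ k / 2 * (x $ k + 2 * (\<Sum>i\<in>UNIV - {k}. x $ i)))"

lemma H_nonneg:
  assumes "\<And>k. 0 < \<theta> $ k" and "x \<in> nonneg_orthant"
  shows "H \<theta> x \<in> nonneg_orthant"
  using assms unfolding nonneg_orthant_def H_def
  by (auto intro!: mult_nonneg_nonneg add_nonneg_nonneg sum_nonneg divide_nonneg_nonneg
      simp: less_imp_le)

lemma H_differentiable: "H \<theta> differentiable (at x)"
proof -
  have "(\<lambda>x. H \<theta> x $ k) differentiable (at x)" for k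
    unfolding H_def vec_lambda_beta divide_inverse
    by (intro differentiable_mult differentiable_add differentiable_sum ballI differentiable_const
        bounded_linear_imp_differentiable bounded_linear_vec_nth finite)
  then have "(\<lambda>x. H \<theta> x \<bullet> b) differentiable (at x)" if "b \<in> Basis" for b
    using that by (auto simp: Basis_vec_def inner_axis)
  then show ?thesis
    using differentiable_componentwise_within[of "H \<theta>" x UNIV] by simp
qed

(* Eigenvalues of a real matrix are taken over the complex numbers. *)
definition eigenvalue :: "real^'n^'n \<Rightarrow> complex \<Rightarrow> bool" where
  "eigenvalue A \<mu> \<longleftrightarrow> (\<exists>v. v \<noteq> 0 \<and> map_matrix complex_of_real A *v v = \<mu> *s v)"

definition saddle_fixed_point :: "(real^'n \<Rightarrow> real^'n) \<Rightarrow> real^'n \<Rightarrow> bool" where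
  "saddle_fixed_point f p \<longleftrightarrow>
     f p = p \<and>
     (\<forall>\<mu>. eigenvalue (jacobian f (at p)) \<mu> \<longrightarrow> cmod \<mu> \<noteq> 1) \<and>
     (\<exists>\<mu>. eigenvalue (jacobian f (at p)) \<mu> \<and> cmod \<mu> < 1) \<and>
     (\<exists>\<mu>. eigenvalue (jacobian f (at p)) \<mu> \<and> cmod \<mu> > 1)"

(* f need not be invertible, so the (global) unstable manifold of p is the set of the points of
   the phase space D that have some complete backward orbit in D converging to p.  For H this
   rules out the origin: it is another fixed point, whose only preimage is itself. *)
definition unstable_manifold :: "'a::topological_space set \<Rightarrow> ('a \<Rightarrow> 'a) \<Rightarrow> 'a \<Rightarrow> 'a set" where
  "unstable_manifold D f p =
     {x. \<exists>y :: nat \<Rightarrow> 'a. y 0 = x \<and> (\<forall>m. y m \<in> D \<and> f (y (Suc m)) = y m) \<and> y \<longlonglongrightarrow> p}"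

(* The solution set of x_1 / e_1 = ... = x_n / e_n; meant for e with all coordinates non-zero. *)
definition ratio_line :: "real^'n \<Rightarrow> (real^'n) set" where
  "ratio_line e = {x. \<forall>i j. x $ i / e $ i = x $ j / e $ j}"

end

theory Submission
  imports Defs
begin

text \<open>
  In the relative coordinates \<open>u\<^sub>k = x\<^sub>k / E\<^sub>k\<close>, with \<open>S = \<Sum>i. E\<^sub>i\<close> and the weighted
  mean \<open>a = (\<Sum>i. E\<^sub>i u\<^sub>i) / S\<close>, the operator reads \<open>u\<^sub>k' = u\<^sub>k (a - c\<^sub>k (u\<^sub>k - a))\<close> where
  \<open>c\<^sub>k = E\<^sub>k / (2 S - E\<^sub>k) < 1\<close>. Where \<open>u > 0\<close> and \<open>c\<^sub>k u\<^sub>k \<le> a\<close> for all \<open>k\<close>, in particular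
  near \<open>E\<close>, this forces every \<open>u\<^sub>k'\<close> to lie between \<open>a min u\<close> and \<open>a max u\<close>, so the ratio
  \<open>max u / min u\<close> does not increase. Along a backward orbit converging to \<open>E\<close> this ratio is
  therefore eventually nondecreasing, yet it tends to 1. So it equals 1 from some index on, and the
  orbit lies on the line through the origin and \<open>E\<close>. On the line, \<open>H (t E) = t\<^sup>2 E\<close>.
\<close>

section \<open>The operator under scaling, and the line through the origin and a point\<close>

lemma H_nth:
  "H \<theta> x $ k = \<theta> $ k * x $ k / 2 * (2 * (\<Sum>i\<in>UNIV. x $ i) - x $ k)"
proof -
  have "(\<Sum>i\<in>UNIV. x $ i) = x $ k + (\<Sum>i\<in>UNIV - {k}. x $ i)"
    by (simp add: sum.remove)
  then show ?thesis
    by (simp add: H_def)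
qed

lemma H_scaleR: "H \<theta> (t *\<^sub>R x) = t\<^sup>2 *\<^sub>R H \<theta> x"
  by (simp add: vec_eq_iff H_nth sum_distrib_left[symmetric] power2_eq_square algebra_simps)

lemma ratio_line_eq_range:
  fixes e :: "real^'n"
  assumes "\<And>i. e $ i \<noteq> 0"
  shows "ratio_line e = range (\<lambda>t. t *\<^sub>R e)"
proof
  show "range (\<lambda>t. t *\<^sub>R e) \<subseteq> ratio_line e"
    using assms by (auto simp: ratio_line_def)
  show "ratio_line e \<subseteq> range (\<lambda>t. t *\<^sub>R e)"
  proof
    fix x assume x: "x \<in> ratio_line e"
    \<comment> \<open>All ratios agree on the line, so any index serves; \<open>undefined\<close>
      names one.\<close>
    define t where "t = x $ undefined / e $ undefined"
    have "x $ i = t * e $ i" for i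
    proof -
      have "x $ i / e $ i = t"
        using x unfolding ratio_line_def t_def by blast
      then show ?thesis using assms[of i] by (metis nonzero_eq_divide_eq)
    qed
    then have "x = t *\<^sub>R e"
      by (simp add: vec_eq_iff)
    then show "x \<in> range (\<lambda>t. t *\<^sub>R e)" by blast
  qed
qed

lemma ratio_line_eq_affine_hull:
  fixes e :: "real^'n"
  assumes "\<And>i. e $ i \<noteq> 0"
  shows "ratio_line e = affine hull {0, e}"
proof -
  have "affine hull {0, e} = span {0, e}"
    by (intro affine_hull_span_0) (simp add: hull_inc)
  also have "\<dots> = range (\<lambda>t. t *\<^sub>R e)"
    by (simp add: span_insert_0 span_singleton)
  finally show ?thesis
    using ratio_line_eq_range[of e] assms by simp
qed

section \<open>Elementary symmetric sums one degree below the top\<close>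

lemma subsets_card_pred_eq_image:
  assumes "finite A" "A \<noteq> {}"
  shows "{I. I \<subseteq> A \<and> card I = card A - 1} = (\<lambda>j. A - {j}) ` A"
proof (intro set_eqI iffI)
  fix I assume "I \<in> {I. I \<subseteq> A \<and> card I = card A - 1}"
  then have I: "I \<subseteq> A" "card I = card A - 1" by auto
  have "card (A - I) = card A - card I"
    using I assms by (meson card_Diff_subset finite_subset)
  moreover have "card A > 0" using assms by (simp add: card_gt_0_iff)
  ultimately have "card (A - I) = 1" using I by simp
  then obtain j where "A - I = {j}" by (auto simp: card_1_singleton_iff)
  then show "I \<in> (\<lambda>j. A - {j}) ` A" using I by blast
qed (use assms in auto)

text \<open>Each such subset omits exactly one index \<open>j\<close>, which divides the full
  product by \<open>f j\<close>.\<close>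

lemma sum_prod_subsets_card_pred:
  fixes f :: "'a \<Rightarrow> 'b::field"
  assumes "finite A" "A \<noteq> {}" "\<And>j. j \<in> A \<Longrightarrow> f j \<noteq> 0"
  shows "(\<Sum>I | I \<subseteq> A \<and> card I = card A - 1. \<Prod>j\<in>I. f j) = (\<Prod>j\<in>A. f j) * (\<Sum>j\<in>A. 1 / f j)"
proof -
  have "(\<Sum>I | I \<subseteq> A \<and> card I = card A - 1. \<Prod>j\<in>I. f j) = (\<Sum>j\<in>A. \<Prod>i\<in>A - {j}. f i)"
    unfolding subsets_card_pred_eq_image[OF assms(1,2)]
    by (subst sum.reindex) (auto simp: inj_on_def)
  also have "\<dots> = (\<Sum>j\<in>A. (\<Prod>i\<in>A. f i) * (1 / f j))"
    using assms by (intro sum.cong refl) (simp add: prod.remove)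
  finally show ?thesis by (simp add: sum_distrib_left)
qed

section \<open>Coordinates of a positive fixed point\<close>

locale positive_fixed_point =
  fixes \<theta> E :: "real^'n"
  assumes card: "CARD('n) \<ge> 2"
    and theta_pos: "\<And>k. \<theta> $ k > 0"
    and E_pos: "\<And>k. E $ k > 0"
    and fixed: "H \<theta> E = E"
begin

definition S :: real where "S = (\<Sum>i\<in>UNIV. E $ i)"

lemma other_indices_nonempty: "UNIV - {k :: 'n} \<noteq> {}"
proof
  assume "UNIV - {k} = {}"
  then have "UNIV = {k}" by auto
  then have "CARD('n) = 1" by (metis card_1_singleton_iff One_nat_def)
  then show False using card by simp
qed

lemma E_less_S: "E $ k < S"
proof -
  have "(\<Sum>i\<in>UNIV - {k}. E $ i) > 0"
    by (intro sum_pos other_indices_nonempty) (auto simp: E_pos)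
  moreover have "S = E $ k + (\<Sum>i\<in>UNIV - {k}. E $ i)"
    by (simp add: S_def sum.remove)
  ultimately show ?thesis by simp
qed

lemma S_pos: "S > 0"
  using E_less_S E_pos less_trans by blast

text \<open>Cancelling \<open>E $ k > 0\<close> in the fixed-point equation leaves an equation that
  is linear in the coordinates of \<open>E\<close>.\<close>

lemma theta_eq: "\<theta> $ k = 2 / (2 * S - E $ k)"
proof -
  have "\<theta> $ k * E $ k / 2 * (2 * S - E $ k) = E $ k"
    using fixed H_nth[of \<theta> E k] by (simp add: S_def)
  then have "E $ k * (\<theta> $ k * (2 * S - E $ k)) = E $ k * 2"
    by (simp add: mult_ac)
  then have "\<theta> $ k * (2 * S - E $ k) = 2"
    using E_pos[of k] by simp
  moreover have "2 * S - E $ k \<noteq> 0"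
    using E_less_S[of k] S_pos by linarith
  ultimately show ?thesis by (simp add: field_simps)
qed

lemma E_eq: "E $ k = 2 * S - 2 / \<theta> $ k"
  using E_less_S[of k] S_pos by (simp add: theta_eq field_simps)

text \<open>Summing \<open>E_eq\<close> over all indices gives one linear equation for
  \<open>S\<close>.\<close>

lemma S_eq: "(2 * real CARD('n) - 1) * S = 2 * (\<Sum>i\<in>UNIV. 1 / \<theta> $ i)"
proof -
  have E: "E $ i = 2 * S - 2 * (1 / \<theta> $ i)" for i
    by (simp add: E_eq)
  have "S = (\<Sum>i\<in>UNIV. E $ i)"
    by (fact S_def)
  also have "\<dots> = (\<Sum>i\<in>UNIV. 2 * S - 2 * (1 / \<theta> $ i))"
    by (rule sum.cong[OF refl E])
  also have "\<dots> = real CARD('n) * (2 * S) - 2 * (\<Sum>i\<in>UNIV. 1 / \<theta> $ i)"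
    unfolding sum_subtractf sum_distrib_left[symmetric] by simp
  finally show ?thesis by (simp add: algebra_simps)
qed

text \<open>The value of \<open>S\<close> from \<open>S_eq\<close> is inserted into
  \<open>E_eq\<close>. With \<open>P\<close> the product and \<open>T\<close> the sum of reciprocals
  over the indices other than \<open>i\<close>, the sum over subsets is
  \<open>P * T\<close>.\<close>

lemma E_formula:
  "E $ i =
      (4 * \<theta> $ i * (\<Sum>I | I \<subseteq> UNIV - {i} \<and> card I = CARD('n) - 2. \<Prod>j\<in>I. \<theta> $ j)
        - (4 * real CARD('n) - 6) * (\<Prod>j\<in>UNIV - {i}. \<theta> $ j))
      / ((2 * real CARD('n) - 1) * (\<Prod>j\<in>UNIV. \<theta> $ j))"
proof -
  define n where "n = real CARD('n)"
  define P where "P = (\<Prod>j\<in>UNIV - {i}. \<theta> $ j)"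
  define T where "T = (\<Sum>j\<in>UNIV - {i}. 1 / \<theta> $ j)"
  have "card (UNIV - {i} :: 'n set) = CARD('n) - 1"
    by simp
  then have c: "card (UNIV - {i} :: 'n set) - 1 = CARD('n) - 2"
    by linarith
  have e: "(\<Sum>I | I \<subseteq> UNIV - {i} \<and> card I = CARD('n) - 2. \<Prod>j\<in>I. \<theta> $ j) = P * T"
    unfolding P_def T_def c[symmetric]
    by (rule sum_prod_subsets_card_pred[OF _ other_indices_nonempty])
      (simp_all add: theta_pos less_imp_neq[THEN not_sym])
  have p: "(\<Prod>j\<in>UNIV. \<theta> $ j) = \<theta> $ i * P"
    unfolding P_def by (simp add: prod.remove)
  have "P > 0"
    unfolding P_def by (intro prod_pos) (simp add: theta_pos)
  define r where "r = 1 / \<theta> $ i"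
  have "(\<Sum>j\<in>UNIV. 1 / \<theta> $ j) = r + T"
    unfolding T_def r_def by (simp add: sum.remove)
  then have S: "(2 * n - 1) * S = 2 * (r + T)"
    using S_eq by (simp add: n_def)
  have n: "2 * n - 1 > 0" using card by (simp add: n_def)
  have "(2 * n - 1) * E $ i = 2 * ((2 * n - 1) * S) - (2 * n - 1) * (2 * r)"
    by (simp add: E_eq r_def right_diff_distrib)
  \<comment> \<open>The coefficient of \<open>r\<close> is 4 - 2(2n - 1) = -(4n - 6).\<close>
  also have "\<dots> * \<theta> $ i = 4 * \<theta> $ i * T - (4 * n - 6) * (r * \<theta> $ i)"
    unfolding S by (simp add: algebra_simps)
  finally have "(2 * n - 1) * E $ i * \<theta> $ i = 4 * \<theta> $ i * T - (4 * n - 6)"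
    using theta_pos[of i] by (simp add: r_def)
  then have "E $ i * ((2 * n - 1) * (\<theta> $ i * P)) = (4 * \<theta> $ i * T - (4 * n - 6)) * P"
    by (simp add: mult_ac)
  moreover have "(2 * n - 1) * (\<theta> $ i * P) \<noteq> 0"
    using n \<open>P > 0\<close> theta_pos[of i] by simp
  ultimately have "E $ i = (4 * \<theta> $ i * T - (4 * n - 6)) * P / ((2 * n - 1) * (\<theta> $ i * P))"
    by (simp add: nonzero_eq_divide_eq)
  then show ?thesis
    unfolding e p n_def[symmetric] P_def[symmetric] by (simp add: algebra_simps)
qed

section \<open>Dynamics in relative coordinates\<close>

definition rel :: "real^'n \<Rightarrow> 'n \<Rightarrow> real" where
  "rel x k = x $ k / E $ k"

definition mean :: "real^'n \<Rightarrow> real" where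
  "mean x = (\<Sum>i\<in>UNIV. x $ i) / S"

lemma nth_eq_rel: "x $ k = E $ k * rel x k"
  using E_pos[of k] by (simp add: rel_def)

lemma rel_H:
  "rel (H \<theta> x) k = rel x k * (mean x - E $ k / (2 * S - E $ k) * (rel x k - mean x))"
proof -
  define d where "d = 2 * S - E $ k"
  have d: "d \<noteq> 0" using E_less_S[of k] S_pos by (simp add: d_def)
  have s: "(\<Sum>i\<in>UNIV. x $ i) = S * mean x"
    using S_pos by (simp add: mean_def)
  have "H \<theta> x $ k = E $ k * (rel x k * (2 * (S * mean x) - E $ k * rel x k) / d)"
    by (simp add: H_nth s theta_eq d_def[symmetric] nth_eq_rel[of x k])
  then have "rel (H \<theta> x) k = rel x k * (2 * (S * mean x) - E $ k * rel x k) / d"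
    using E_pos[of k] by (simp add: rel_def[of "H \<theta> x"])
  \<comment> \<open>The split makes the coefficient of \<open>mean x\<close> equal to the
    denominator \<open>d\<close>, which then cancels.\<close>
  also have "2 * (S * mean x) - E $ k * rel x k = d * mean x - E $ k * (rel x k - mean x)"
    by (simp add: d_def algebra_simps)
  also have "rel x k * \<dots> / d = rel x k * (mean x - E $ k / d * (rel x k - mean x))"
    using d by (simp add: field_simps)
  finally show ?thesis by (simp add: d_def)
qed

text \<open>By \<open>nth_eq_rel\<close>, \<open>mean x\<close> averages \<open>rel x\<close> with
  the weights \<open>E $ k / S\<close>, which are positive and sum to 1.\<close>

lemma mean_bounds:
  assumes "\<And>k. l \<le> rel x k" "\<And>k. rel x k \<le> u"
  shows "l \<le> mean x" "mean x \<le> u"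
proof -
  have x: "(\<Sum>k\<in>UNIV. x $ k) = (\<Sum>k\<in>UNIV. E $ k * rel x k)"
    by (simp add: nth_eq_rel[of x])
  have "S * l \<le> (\<Sum>k\<in>UNIV. x $ k)" "(\<Sum>k\<in>UNIV. x $ k) \<le> S * u"
    unfolding x S_def sum_distrib_right
    by (intro sum_mono mult_left_mono assms less_imp_le[OF E_pos])+
  then show "l \<le> mean x" "mean x \<le> u"
    using S_pos by (simp_all add: mean_def pos_le_divide_eq pos_divide_le_eq mult.commute)
qed

text \<open>The region where one step cannot increase the ratio of the largest to the smallest
  relative coordinate. Distances to \<open>E\<close> may still grow.\<close>

definition contracting :: "real^'n \<Rightarrow> bool" where
  "contracting x \<longleftrightarrow> (\<forall>k. 0 < rel x k \<and> E $ k / (2 * S - E $ k) * rel x k \<le> mean x)"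

text \<open>The image w of v lies between \<open>v * a\<close> and \<open>a * a\<close>: the
  differences w - va = cv(a - v) and w - aa = (v - a)(a - cv) have opposite signs or vanish, since
  \<open>c * v \<le> a\<close>. Both ends lie between \<open>l * a\<close> and
  \<open>u * a\<close>.\<close>

lemma rel_H_bounds:
  assumes x: "contracting x" and l: "\<And>k. l \<le> rel x k" and u: "\<And>k. rel x k \<le> u"
  shows "l * mean x \<le> rel (H \<theta> x) k" "rel (H \<theta> x) k \<le> u * mean x"
proof -
  define a v c where "a = mean x" and "v = rel x k" and "c = E $ k / (2 * S - E $ k)"
  have c: "0 \<le> c" "c \<le> 1"
    using E_less_S[of k] E_pos[of k] by (auto simp: c_def)
  have v: "0 < v" "c * v \<le> a" "l \<le> v" "v \<le> u"
    using x l u by (auto simp: contracting_def v_def c_def a_def)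
  have a: "l \<le> a" "a \<le> u"
    using mean_bounds[of l x u] l u by (auto simp: a_def)
  have "0 \<le> a" using v c by (meson mult_nonneg_nonneg less_imp_le order_trans)
  have eq: "rel (H \<theta> x) k = v * (a - c * (v - a))"
    by (simp add: rel_H v_def a_def c_def)
  have d: "v * (a - c * (v - a)) - v * a = c * v * (a - v)"
    "v * (a - c * (v - a)) - a * a = (v - a) * (a - c * v)"
    by (simp_all add: algebra_simps)
  have "l * a \<le> v * a" "v * a \<le> u * a" "l * a \<le> a * a" "a * a \<le> u * a"
    using v a \<open>0 \<le> a\<close> by (auto intro!: mult_right_mono)
  moreover have "v * (a - c * (v - a)) \<le> v * a \<and> a * a \<le> v * (a - c * (v - a))" if "a \<le> v"
  proof -
    have "v * (a - c * (v - a)) - v * a \<le> 0"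
      unfolding d using that c v by (intro mult_nonneg_nonpos) auto
    moreover have "0 \<le> v * (a - c * (v - a)) - a * a"
      unfolding d using that v by (intro mult_nonneg_nonneg) auto
    ultimately show ?thesis by simp
  qed
  moreover have "v * a \<le> v * (a - c * (v - a)) \<and> v * (a - c * (v - a)) \<le> a * a" if "v \<le> a"
  proof -
    have "0 \<le> v * (a - c * (v - a)) - v * a"
      unfolding d using that c v by (intro mult_nonneg_nonneg) auto
    moreover have "v * (a - c * (v - a)) - a * a \<le> 0"
      unfolding d using that v by (intro mult_nonpos_nonneg) auto
    ultimately show ?thesis by simp
  qed
  ultimately have "l * a \<le> rel (H \<theta> x) k \<and> rel (H \<theta> x) k \<le> u * a"
    unfolding eq by (meson le_cases order_trans)
  then show "l * mean x \<le> rel (H \<theta> x) k" "rel (H \<theta> x) k \<le> u * mean x"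
    by (auto simp: a_def)
qed

text \<open>With \<open>l\<close> and \<open>u\<close> the extreme relative coordinates, both bounds
  of \<open>rel_H_bounds\<close> carry the same factor \<open>mean x\<close>, so
  \<open>u \<le> q * l\<close> passes to the image.\<close>

lemma rel_ratio_H_le:
  assumes "contracting x" and q: "\<And>i j. rel x i \<le> q * rel x j"
  shows "rel (H \<theta> x) i \<le> q * rel (H \<theta> x) j"
proof -
  define l u where "l = Min (range (rel x))" and "u = Max (range (rel x))"
  have b: "l \<le> rel x k" "rel x k \<le> u" for k
    by (auto simp: l_def u_def)
  have "l \<in> range (rel x)" "u \<in> range (rel x)"
    unfolding l_def u_def by (intro Min_in Max_in; simp)+
  then have "u \<le> q * l" "0 < l"
    using q \<open>contracting x\<close> by (auto simp: contracting_def)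
  then have "0 \<le> mean x" "0 < u"
    using mean_bounds(1)[OF b] b[of i] by linarith+
  then have "0 < q"
    using \<open>u \<le> q * l\<close> \<open>0 < l\<close> by (metis less_le_trans zero_less_mult_pos2)
  have "rel (H \<theta> x) i \<le> u * mean x"
    using rel_H_bounds(2)[OF \<open>contracting x\<close> b] .
  also have "\<dots> \<le> q * (l * mean x)"
    using mult_right_mono[OF \<open>u \<le> q * l\<close> \<open>0 \<le> mean x\<close>] by (simp add: mult.assoc)
  also have "\<dots> \<le> q * rel (H \<theta> x) j"
    using rel_H_bounds(1)[OF \<open>contracting x\<close> b] \<open>0 < q\<close> by (simp add: mult_left_mono)
  finally show ?thesis .
qed

section \<open>Backward orbits converging to the fixed point\<close>

lemma rel_tendsto:
  assumes "y \<longlonglongrightarrow> E"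
  shows "(\<lambda>m. rel (y m) k) \<longlonglongrightarrow> 1"
proof -
  have "(\<lambda>m. y m $ k / E $ k) \<longlonglongrightarrow> E $ k / E $ k"
    using E_pos[of k] by (intro tendsto_intros assms) auto
  then show ?thesis using E_pos[of k] by (simp add: rel_def)
qed

text \<open>At \<open>E\<close> all relative coordinates and the mean are 1, so the conditions
  become 0 < 1 and \<open>c < 1\<close>. Being strict, they persist nearby.\<close>

lemma eventually_contracting:
  assumes "y \<longlonglongrightarrow> E"
  shows "eventually (\<lambda>m. contracting (y m)) sequentially"
  unfolding contracting_def
proof (rule eventually_all_finite)
  fix k
  define c where "c = E $ k / (2 * S - E $ k)"
  have "c < 1" using E_less_S[of k] S_pos by (auto simp: c_def)
  have "(\<lambda>m. mean (y m)) \<longlonglongrightarrow> S / S"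
    using S_pos unfolding mean_def S_def[symmetric]
    by (intro tendsto_divide tendsto_const) (auto simp: S_def intro!: tendsto_intros assms)
  then have mean: "(\<lambda>m. mean (y m)) \<longlonglongrightarrow> 1" using S_pos by simp
  have "(\<lambda>m. mean (y m) - c * rel (y m) k) \<longlonglongrightarrow> 1 - c * 1"
    by (intro tendsto_intros mean rel_tendsto assms)
  then have "eventually (\<lambda>m. 0 < mean (y m) - c * rel (y m) k) sequentially"
    using \<open>c < 1\<close> by (intro order_tendstoD) auto
  moreover have "eventually (\<lambda>m. 0 < rel (y m) k) sequentially"
    using rel_tendsto[OF assms] by (rule order_tendstoD) simp
  ultimately show "eventually (\<lambda>m. 0 < rel (y m) k \<and>
      E $ k / (2 * S - E $ k) * rel (y m) k \<le> mean (y m)) sequentially"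
    by eventually_elim (auto simp: c_def)
qed

lemma backward_orbit_eventually_on_line:
  assumes orbit: "\<And>m. H \<theta> (y (Suc m)) = y m" and lim: "y \<longlonglongrightarrow> E"
  shows "\<exists>M t. t > 0 \<and> y M = t *\<^sub>R E"
proof -
  obtain M where M: "\<And>m. m \<ge> M \<Longrightarrow> contracting (y m)"
    using eventually_contracting[OF lim] by (auto simp: eventually_sequentially)
  \<comment> \<open>\<open>M\<close> is fixed before \<open>q\<close>. The ratios tend to 1, so
    \<open>q\<close> bounds them at some late \<open>N\<close>.\<close>
  have ratio: "rel (y M) i \<le> q * rel (y M) j" if "q > 1" for q i j
  proof -
    have "(\<lambda>m. q * rel (y m) j - rel (y m) i) \<longlonglongrightarrow> q * 1 - 1" for i j
      by (intro tendsto_intros rel_tendsto lim)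
    then have "eventually (\<lambda>m. 0 < q * rel (y m) j - rel (y m) i) sequentially" for i j
      using that by (intro order_tendstoD) auto
    then have "eventually (\<lambda>m. \<forall>i j. 0 < q * rel (y m) j - rel (y m) i) sequentially"
      by (simp add: eventually_all_finite)
    then obtain N where "N \<ge> M" and N: "\<And>i j. rel (y N) i \<le> q * rel (y N) j"
      by (auto simp: eventually_sequentially) (meson le_cases less_imp_le)
    have "\<forall>i j. rel (y M) i \<le> q * rel (y M) j"
      using \<open>N \<ge> M\<close>
    \<comment> \<open>The induction descends from \<open>N\<close> to \<open>M\<close>, because
      \<open>H \<theta>\<close> sends \<open>y (Suc m)\<close> to \<open>y m\<close>.\<close>
    proof (induction rule: inc_induct)
      case (step m)
      then show ?case
        using rel_ratio_H_le[of "y (Suc m)" q] M[of "Suc m"] orbit[of m] by auto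
    qed (use N in blast)
    then show ?thesis by blast
  qed
  \<comment> \<open>As \<open>M\<close> does not depend on \<open>q\<close>, letting
    \<open>q\<close> decrease to 1 gives the inequality in both directions, hence equality.\<close>
  have le: "rel (y M) i \<le> rel (y M) j" for i j
  proof (rule tendsto_lowerbound)
    show "((\<lambda>q. q * rel (y M) j) \<longlongrightarrow> rel (y M) j) (at_right 1)"
      by (auto intro!: tendsto_eq_intros)
    show "eventually (\<lambda>q. rel (y M) i \<le> q * rel (y M) j) (at_right 1)"
      using eventually_at_right_less[of "1::real"] by eventually_elim (rule ratio)
  qed simp
  define t where "t = rel (y M) undefined"
  have "rel (y M) k = t" for k
    using le by (simp add: t_def antisym)
  then have "y M = t *\<^sub>R E"
    by (simp add: vec_eq_iff nth_eq_rel[of "y M"])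
  moreover have "t > 0"
    using M[of M] by (auto simp: contracting_def t_def)
  ultimately show ?thesis by blast
qed

text \<open>Some \<open>y M\<close> is a positive multiple of \<open>E\<close>. Applying the
  operator \<open>M\<close> times leads back to \<open>x\<close>, squaring the positive factor each
  time.\<close>

lemma unstable_manifold_subset:
  assumes "x \<in> unstable_manifold D (H \<theta>) E"
  shows "\<exists>t>0. x = t *\<^sub>R E"
proof -
  obtain y where y: "y 0 = x" "\<And>m. H \<theta> (y (Suc m)) = y m" "y \<longlonglongrightarrow> E"
    using assms by (auto simp: unstable_manifold_def)
  obtain M where "\<exists>t>0. y M = t *\<^sub>R E"
    using backward_orbit_eventually_on_line[of y] y by auto
  then have "\<exists>t>0. y 0 = t *\<^sub>R E"
  proof (induction M)
    case (Suc M)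
    then obtain t where "t > 0" "y (Suc M) = t *\<^sub>R E" by blast
    then have "y M = t\<^sup>2 *\<^sub>R E" by (metis y(2) H_scaleR fixed)
    then show ?case using Suc.IH \<open>t > 0\<close> by (meson zero_less_power)
  qed
  then show ?thesis using y(1) by simp
qed

lemma scaleR_in_unstable_manifold:
  assumes "t > 0"
  shows "t *\<^sub>R E \<in> unstable_manifold nonneg_orthant (H \<theta>) E"
proof -
  \<comment> \<open>The operator squares the factor on the line, so repeated square roots give a
    backward orbit; the exponents tend to 0 and the factors to 1.\<close>
  define y where "y m = (t powr ((1/2) ^ m)) *\<^sub>R E" for m :: nat
  have "y m \<in> nonneg_orthant" for m
    using E_pos by (auto simp: y_def nonneg_orthant_def less_imp_le)
  moreover have "H \<theta> (y (Suc m)) = y m" for m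
    by (simp add: y_def H_scaleR fixed power2_eq_square powr_add[symmetric])
  moreover have "(\<lambda>m. (t powr ((1/2) ^ m)) *\<^sub>R E) \<longlonglongrightarrow> (t powr 0) *\<^sub>R E"
    using assms by (intro tendsto_intros LIMSEQ_power_zero) auto
  then have "y \<longlonglongrightarrow> E" using assms by (simp add: y_def[abs_def])
  moreover have "y 0 = t *\<^sub>R E" using assms by (simp add: y_def)
  ultimately show ?thesis unfolding unstable_manifold_def by blast
qed

text \<open>Both sides are the open ray of positive multiples of \<open>E\<close>.\<close>

lemma unstable_manifold_eq:
  "unstable_manifold nonneg_orthant (H \<theta>) E = ratio_line E \<inter> nonneg_orthant - {0}"
proof -
  have line: "ratio_line E = range (\<lambda>t. t *\<^sub>R E)"
    using E_pos by (intro ratio_line_eq_range) (simp add: less_imp_neq[THEN not_sym])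
  have pos: "t *\<^sub>R E \<in> nonneg_orthant - {0} \<longleftrightarrow> t > 0" for t
  proof -
    have "E \<noteq> 0" using E_pos by (metis less_irrefl zero_index)
    moreover have "0 \<le> t * E $ k \<longleftrightarrow> 0 \<le> t" for k
      using E_pos[of k] by (simp add: zero_le_mult_iff)
    ultimately show ?thesis by (auto simp: nonneg_orthant_def)
  qed
  show ?thesis
  proof (intro set_eqI iffI)
    fix x assume "x \<in> unstable_manifold nonneg_orthant (H \<theta>) E"
    then obtain t where "t > 0" "x = t *\<^sub>R E" using unstable_manifold_subset by blast
    then show "x \<in> ratio_line E \<inter> nonneg_orthant - {0}"
      using pos[of t] by (simp add: line)
  next
    fix x assume x: "x \<in> ratio_line E \<inter> nonneg_orthant - {0}"
    then obtain t where t: "x = t *\<^sub>R E" unfolding line by blast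
    with x have "t > 0" using pos[of t] by blast
    then show "x \<in> unstable_manifold nonneg_orthant (H \<theta>) E"
      using scaleR_in_unstable_manifold t by simp
  qed
qed

end

theorem proposition14:
  fixes \<theta> E :: "real^'n"
  assumes "CARD('n) \<ge> 2"
    and "\<And>k. \<theta> $ k > 0"
    and "E \<in> nonneg_orthant"
    and "\<And>i. E $ i \<noteq> 0"
    and "saddle_fixed_point (H \<theta>) E"
  shows "unstable_manifold nonneg_orthant (H \<theta>) E = ratio_line E \<inter> nonneg_orthant - {0} \<and>
    ratio_line E = affine hull {0, E} \<and>
    (\<forall>i. E $ i =
      (4 * \<theta> $ i * (\<Sum>I | I \<subseteq> UNIV - {i} \<and> card I = CARD('n) - 2. \<Prod>j\<in>I. \<theta> $ j)
        - (4 * real CARD('n) - 6) * (\<Prod>j\<in>UNIV - {i}. \<theta> $ j))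
      / ((2 * real CARD('n) - 1) * (\<Prod>j\<in>UNIV. \<theta> $ j)))"
proof -
  interpret positive_fixed_point \<theta> E
  proof
    show "E $ k > 0" for k
      using assms(3) assms(4)[of k] by (simp add: nonneg_orthant_def order.not_eq_order_implies_strict)
    show "H \<theta> E = E"
      using assms(5) by (simp add: saddle_fixed_point_def)
  qed (use assms in auto)
  show ?thesis
    by (intro conjI allI unstable_manifold_eq ratio_line_eq_affine_hull assms(4) E_formula)
qed

end
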